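(* There is an absolute constant $\gamma>0$ such that for all sufficiently large $k$, every non-adaptive $(0.1,0.2)$-tolerant tester for the property of being a $k$-junta, for functions $f:\{0,1\}^{2k}\to\{0,1\}$, must make at least $2^{\gamma\sqrt{k}}$ queries.
   Context: A $k$-junta is a function $f:\{0,1\}^n\to\{0,1\}$ depending on at most $k$ of its $n$ coordinates. For $f,g$, $\mathrm{dist}(f,g)=\Pr_{x\sim\{0,1\}^n}[f(x)\ne g(x)]$ with $x$ uniform, and $\mathrm{dist}(f,\mathcal P)=\min_{g\in\mathcal P}\mathrm{dist}(f,g)$. For $0\le\epsilon_1<\epsilon_2$, an $(\epsilon_1,\epsilon_2)$-tolerant tester for $\mathcal P$ is a randomized query algorithm that accepts with probability at least $2/3$ whenever $\mathrm{dist}(f,\mathcal P)\le\epsilon_1$ and rejects with probability at least $2/3$ whenever $\mathrm{dist}(f,\mathcal P)\ge\epsilon_2$. A tester is non-adaptive if all its query points are chosen before seeing any answers. *)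

theory Defs
  imports "HOL-Probability.Probability_Mass_Function"
begin

definition cube :: "nat \<Rightarrow> bool list set" where
  "cube n = {x. length x = n}"

definition is_junta :: "nat \<Rightarrow> nat \<Rightarrow> (bool list \<Rightarrow> bool) \<Rightarrow> bool" where
  "is_junta n k f \<longleftrightarrow> (\<exists>S \<subseteq> {..<n}. card S \<le> k \<and>
     (\<forall>x\<in>cube n. \<forall>y\<in>cube n. (\<forall>i\<in>S. x ! i = y ! i) \<longrightarrow> f x = f y))"

definition fdist :: "nat \<Rightarrow> (bool list \<Rightarrow> bool) \<Rightarrow> (bool list \<Rightarrow> bool) \<Rightarrow> real" where
  "fdist n f g = real (card {x \<in> cube n. f x \<noteq> g x}) / 2 ^ n"

definition dist_junta :: "nat \<Rightarrow> nat \<Rightarrow> (bool list \<Rightarrow> bool) \<Rightarrow> real" where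
  "dist_junta n k f = Inf {fdist n f g | g. is_junta n k g}"

text \<open>A non-adaptive randomized tester with q queries: a probability distribution over
  pairs (Q, D) of a query list Q (at most q points of the cube, fixed before any answer)
  and a decision rule D applied to the list of answers (True = accept).\<close>
definition nonadaptive_tester :: "nat \<Rightarrow> nat \<Rightarrow> (bool list list \<times> (bool list \<Rightarrow> bool)) pmf \<Rightarrow> bool" where
  "nonadaptive_tester n q T \<longleftrightarrow>
     (\<forall>(Q, D) \<in> set_pmf T. length Q \<le> q \<and> set Q \<subseteq> cube n)"

definition accept_prob :: "(bool list list \<times> (bool list \<Rightarrow> bool)) pmf \<Rightarrow> (bool list \<Rightarrow> bool) \<Rightarrow> real" where
  "accept_prob T f = measure_pmf.prob T {(Q, D). D (map f Q)}"

definition tolerant_junta_tester :: "nat \<Rightarrow> nat \<Rightarrow> real \<Rightarrow> real \<Rightarrow>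
    (bool list list \<times> (bool list \<Rightarrow> bool)) pmf \<Rightarrow> bool" where
  "tolerant_junta_tester n k eps1 eps2 T \<longleftrightarrow>
     (\<forall>f. dist_junta n k f \<le> eps1 \<longrightarrow> accept_prob T f \<ge> 2/3) \<and>
     (\<forall>f. dist_junta n k f \<ge> eps2 \<longrightarrow> 1 - accept_prob T f \<ge> 2/3)"

end

theory Submission
  imports Defs
begin

text \<open>Pick a random half \<open>C\<close> of the \<open>2k\<close> coordinates and a uniformly random function \<open>u\<close> on the
  \<open>C\<close>-part of the input. The yes function is \<open>u\<close>, overwritten by \<open>False\<close> where the weight on the
  complement of \<open>C\<close> is within about \<open>t/2\<close> of \<open>k/2\<close>; the no function moreover negates \<open>u\<close> below
  this band. With \<open>t \<approx> \<surd>k / 10\<close> the band has measure at most \<open>1/10\<close>. To tell the two apart one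
  needs queries on opposite sides of the band with the same \<open>C\<close>-part. Such queries differ in at
  least \<open>t\<close> coordinates, all of which must avoid \<open>C\<close>, which has probability at most \<open>2^-t\<close>;
  so about \<open>2^(t/2)\<close> queries are required.\<close>

section \<open>Counting\<close>

text \<open>Consecutive central binomials have ratio 2(2n+1)/(n+1), and 4(2n+1)(2n+3) is at most
  16(n+1)^2, so the bound survives each step. Keeping it squared gives the 1/sqrt(n) saving over 4^n
  within the naturals.\<close>

lemma central_binomial_sq_le: "((2*n) choose n)\<^sup>2 * (2*n+1) \<le> (16::nat)^n"
proof (induction n)
  case 0 then show ?case by simp
next
  case (Suc n)
  define c where "c = (2*n) choose n"
  define d where "d = (2 * Suc n) choose Suc n"
  have rec: "d * (n+1) = 2 * (2*n+1) * c"
  proof -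
    have 1: "Suc n * (Suc (2*n+1) choose Suc n) = Suc (2*n+1) * ((2*n+1) choose n)"
      by (rule Suc_times_binomial)
    have 2: "Suc n * ((2*n+1) choose Suc n) = (2*n+1) * ((2*n) choose n)"
      using Suc_times_binomial[of n "2*n"] by simp
    have 3: "(2*n+1) choose Suc n = (2*n+1) choose n"
      using binomial_symmetric[of n "2*n+1"] by simp
    show ?thesis using 1 2 3 unfolding c_def d_def by (simp add: algebra_simps)
  qed
  have "d\<^sup>2 * (2*Suc n+1) * (n+1)\<^sup>2 = (d * (n+1))\<^sup>2 * (2*n+3)"
  proof -
    have "2*Suc n+1 = 2*n+3" by simp
    then show ?thesis unfolding power_mult_distrib by (simp only: ac_simps)
  qed
  also have "\<dots> = 4 * (2*n+1) * (2*n+3) * (c\<^sup>2 * (2*n+1))"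
    unfolding rec by (simp add: power2_eq_square algebra_simps)
  also have "\<dots> \<le> 4 * (2*n+1) * (2*n+3) * 16^n"
    using Suc by (intro mult_left_mono) (auto simp: c_def)
  also have "\<dots> \<le> (16 * (n+1)\<^sup>2) * 16^n"
    by (intro mult_right_mono) (auto simp: power2_eq_square algebra_simps)
  finally have "d\<^sup>2 * (2*Suc n+1) * (n+1)\<^sup>2 \<le> 16^Suc n * (n+1)\<^sup>2"
    by (simp add: algebra_simps)
  then show ?case unfolding d_def[symmetric] by (simp only: mult_le_cancel2) simp
qed

text \<open>The middle coefficient is the largest. For even k it is central; for k = 2n+1 it is
  exactly half of the next central one, which transfers the bound.\<close>

lemma binomial_sq_le: "(k choose j)\<^sup>2 * (k+1) \<le> (4::nat)^k"
proof -
  have le: "(k choose j)\<^sup>2 * (k+1) \<le> (k choose (k div 2))\<^sup>2 * (k+1)"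
    by (intro mult_right_mono power_mono binomial_maximum) auto
  show ?thesis
  proof (cases "even k")
    case True
    then obtain n where k: "k = 2*n" by blast
    show ?thesis using le central_binomial_sq_le[of n] unfolding k
      by (simp add: power_mult)
  next
    case False
    then obtain n where k: "k = 2*n+1" using oddE by blast
    have "(2*n+1) choose Suc n = (2*n+1) choose n"
      using binomial_symmetric[of n "2*n+1"] by simp
    then have "(2*Suc n) choose Suc n = 2 * ((2*n+1) choose n)" by simp
    then have "(2 * ((2*n+1) choose n))\<^sup>2 * (2 * Suc n + 1) \<le> 16 ^ Suc n"
      by (metis central_binomial_sq_le)
    moreover have "2 * Suc n + 1 = 2*n+3" by simp
    ultimately have "4 * (((2*n+1) choose n)\<^sup>2 * (2*n+3)) \<le> 4 * (4 * 16^n)"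
      unfolding power_mult_distrib by (simp only: power_Suc) simp
    then have "((2*n+1) choose n)\<^sup>2 * (2*n+3) \<le> 4 * 16^n" by linarith
    moreover have "((2*n+1) choose n)\<^sup>2 * (2*n+2) \<le> ((2*n+1) choose n)\<^sup>2 * (2*n+3)"
      by (intro mult_left_mono) auto
    ultimately show ?thesis using le unfolding k by (simp add: power_mult)
  qed
qed

text \<open>Lowering the top from m to m-1 multiplies the coefficient by (m-k)/m, which is at most
  1/2 while m is at most 2k. In probabilistic terms, a random half of 2k coordinates misses d given
  ones with probability at most 2^-d.\<close>

lemma binomial_diff_le: "d \<le> 2*k \<Longrightarrow> 2^d * ((2*k-d) choose k) \<le> (2*k) choose k"
proof (induction d)
  case 0 then show ?case by simp
next
  case (Suc d)
  show ?case
  proof (cases "Suc d \<le> k")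
    case False
    then have "(2*k - Suc d) choose k = 0" using Suc.prems by (intro binomial_eq_0) linarith
    then show ?thesis by (simp only: mult_0_right)
  next
    case True
    define m where "m = 2*k - d"
    have m: "m > k" "m \<le> 2*k" "2*k - Suc d = m - 1" using True by (auto simp: m_def)
    have "m * ((m-1) choose k) = (m-k) * (m choose k)"
      by (metis binomial_absorb_comp)
    then have "m * (2 * ((m-1) choose k)) = (2*(m-k)) * (m choose k)" by simp
    also have "\<dots> \<le> m * (m choose k)" using m by (intro mult_right_mono) auto
    finally have "2 * ((m-1) choose k) \<le> m choose k" using m by simp
    then have "2^d * (2 * ((m-1) choose k)) \<le> 2^d * (m choose k)" by simp
    also have "\<dots> \<le> (2*k) choose k" using Suc unfolding m_def by simp
    finally show ?thesis unfolding m(3) power_Suc by (simp only: mult.assoc mult.left_commute)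
  qed
qed

text \<open>For a uniform subset of \<open>N\<close>, the traces on \<open>C\<close> and off
  \<open>C\<close> are independent; every measure estimate for the hard functions factors in this
  way.\<close>

lemma card_Pow_split:
  assumes "finite N" "C \<subseteq> N"
  shows "card {X\<in>Pow N. P (X\<inter>C) \<and> R (X-C)} = card {Z\<in>Pow C. P Z} * card {Y\<in>Pow (N-C). R Y}"
proof -
  let ?L = "{X\<in>Pow N. P (X\<inter>C) \<and> R (X-C)}"
  let ?R = "{Z\<in>Pow C. P Z} \<times> {Y\<in>Pow (N-C). R Y}"
  let ?f = "\<lambda>X. (X\<inter>C, X-C)"
  have inj: "inj_on ?f ?L" by (auto simp: inj_on_def)
  have im: "?f ` ?L = ?R"
  proof
    show "?R \<subseteq> ?f ` ?L"
    proof
      fix p assume "p \<in> ?R"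
      then obtain Z Y where p: "p = (Z, Y)" and Z: "Z \<subseteq> C" "P Z" and Y: "Y \<subseteq> N - C" "R Y" by auto
      have eq: "(Z \<union> Y) \<inter> C = Z" "(Z \<union> Y) - C = Y" using Z Y by auto
      have "Z \<union> Y \<in> ?L" using Z Y assms by (simp add: eq) blast
      moreover have "p = ?f (Z \<union> Y)" by (simp only: p eq)
      ultimately show "p \<in> ?f ` ?L" by (rule rev_image_eqI)
    qed
    show "?f ` ?L \<subseteq> ?R" by blast
  qed
  have "card ?L = card ?R" using card_image[OF inj] unfolding im by (rule sym)
  then show ?thesis by (simp add: card_cartesian_product)
qed

text \<open>The band contains at most \<open>t\<close> weights, and each weight class has density at
  most 1/sqrt(k+1); with t at most sqrt(k)/10 the total is at most 1/10. The comparison is made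
  between squares to avoid the root.\<close>

lemma card_middle_le:
  assumes A: "finite A" "card A = k" and t: "100 * t\<^sup>2 \<le> k"
  shows "10 * card {Y\<in>Pow A. k < 2 * card Y + t \<and> 2 * card Y < k + t} \<le> 2^k"
proof -
  define b where "b = k choose (k div 2)"
  define W where "W = {w. k < 2*w+t \<and> 2*w < k+t}"
  \<comment> \<open>The least weight w with 2w > k - t.\<close>
  define a where "a = (k-t) div 2 + 1"
  have "t \<le> k" using t le_square[of t] unfolding power2_eq_square by linarith
  have "W \<subseteq> {a..<a+t}"
  proof
    fix w assume "w \<in> W"
    then have w: "k < 2*w+t" "2*w < k+t" by (auto simp: W_def)
    define h where "h = (k-t) div 2"
    have h: "2*h \<le> k-t" "k-t \<le> 2*h+1" by (auto simp: h_def)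
    then have "h < w" "w < h + 1 + t" using w \<open>t \<le> k\<close> by linarith+
    then show "w \<in> {a..<a+t}" by (auto simp: a_def h_def)
  qed
  then have W: "finite W" "card W \<le> t"
    using finite_subset card_mono[of "{a..<a+t}" W] by auto
  have "{Y\<in>Pow A. k < 2 * card Y + t \<and> 2 * card Y < k + t} = (\<Union>w\<in>W. {Y. Y \<subseteq> A \<and> card Y = w})"
    by (auto simp: W_def)
  then have "card {Y\<in>Pow A. k < 2 * card Y + t \<and> 2 * card Y < k + t}
      \<le> (\<Sum>w\<in>W. card {Y. Y \<subseteq> A \<and> card Y = w})"
    using card_UN_le[OF W(1)] by metis
  also have "\<dots> = (\<Sum>w\<in>W. k choose w)" using A by (simp add: n_subsets)
  also have "\<dots> \<le> (\<Sum>w\<in>W. b)" unfolding b_def by (intro sum_mono binomial_maximum)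
  also have "\<dots> \<le> t * b" using W by simp
  finally have le: "10 * card {Y\<in>Pow A. k < 2 * card Y + t \<and> 2 * card Y < k + t} \<le> 10 * (t * b)"
    by simp
  have "(10 * (t*b))\<^sup>2 = (100 * t\<^sup>2) * b\<^sup>2" by (simp add: power_mult_distrib)
  also have "\<dots> \<le> (k+1) * b\<^sup>2" using t by (intro mult_right_mono) auto
  also have "\<dots> \<le> 4^k" using binomial_sq_le[of k "k div 2"] by (simp add: b_def mult.commute)
  also have "\<dots> = (2^k)\<^sup>2" by (simp add: power2_eq_square flip: power_mult_distrib)
  finally have "10 * (t*b) \<le> 2^k" by (rule power2_le_imp_le) simp
  with le show ?thesis by linarith
qed

lemma card_avoiding_subsets_le:
  assumes "D \<subseteq> {..<2*k}" "t \<le> card D"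
  shows "2^t * card {C. C \<subseteq> {..<2*k} \<and> card C = k \<and> C \<inter> D = {}} \<le> (2*k) choose k"
proof -
  have fin: "finite D" using assms finite_subset by blast
  have "{C. C \<subseteq> {..<2*k} \<and> card C = k \<and> C \<inter> D = {}} = {C. C \<subseteq> {..<2*k} - D \<and> card C = k}"
    by auto
  then have "card {C. C \<subseteq> {..<2*k} \<and> card C = k \<and> C \<inter> D = {}} = (2*k - card D) choose k"
    using assms fin by (simp add: n_subsets card_Diff_subset)
  moreover have "2^t * ((2*k - card D) choose k) \<le> 2^card D * ((2*k - card D) choose k)"
    using assms by (intro mult_right_mono power_increasing) auto
  moreover have "card D \<le> 2*k" using card_mono[OF _ assms(1)] by simp
  ultimately show ?thesis using binomial_diff_le[of "card D" k] by (metis order_trans)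
qed

section \<open>Sensitivity of a random function\<close>

text \<open>A family \<open>U\<close> stands for a Boolean function, and an edge in direction
  \<open>i\<close> is recorded by its endpoint without \<open>i\<close>, so each sensitive edge
  counts once.\<close>

definition sens_edges :: "nat \<Rightarrow> nat set \<Rightarrow> nat set set \<Rightarrow> nat set set" where
  "sens_edges i C U = {Z\<in>Pow (C-{i}). (Z \<in> U) \<noteq> (insert i Z \<in> U)}"

text \<open>Distinct edges in one direction share no endpoint, so for uniform \<open>U\<close> their
  signs are uncorrelated with mean square 1. This is the second moment for a Chebyshev
  bound.\<close>

lemma sum_sq_edge_signs:
  fixes i :: nat
  assumes "finite W" "finite B" "B \<subseteq> W" "\<And>Z. Z \<in> B \<Longrightarrow> i \<notin> Z"
  defines "\<sigma> \<equiv> \<lambda>Z U. if (Z \<in> U) \<noteq> (insert i Z \<in> U) then 1 else (-1::real)"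
  shows "(\<Sum>U\<in>Pow W. (\<Sum>Z\<in>B. \<sigma> Z U)\<^sup>2) = real (card B) * 2 ^ card W"
proof -
  have orth: "(\<Sum>U\<in>Pow W. \<sigma> Z U * \<sigma> Z' U) = (if Z = Z' then 2 ^ card W else 0)"
    if Z: "Z \<in> B" "Z' \<in> B" for Z Z'
  proof (cases "Z = Z'")
    case True
    have "\<sigma> Z' U * \<sigma> Z' U = 1" for U by (simp add: \<sigma>_def)
    then show ?thesis using True assms by (simp add: card_Pow)
  next
    case False
    \<comment> \<open>Toggling \<open>Z\<close> in \<open>U\<close> flips the sign of the edge at
      \<open>Z\<close> and leaves the edge at \<open>Z'\<close> alone, so the correlation equals its
      own negative.\<close>
    let ?h = "\<lambda>U. sym_diff U {Z}"
    have bij: "bij_betw ?h (Pow W) (Pow W)"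
      by (rule bij_betwI[where g="?h"]) (use Z assms in auto)
    have ne: "insert i Z \<noteq> Z" "Z \<noteq> insert i Z'" "Z \<noteq> Z'" using Z assms(4) False by blast+
    have "(\<Sum>U\<in>Pow W. \<sigma> Z U * \<sigma> Z' U) = (\<Sum>U\<in>Pow W. \<sigma> Z (?h U) * \<sigma> Z' (?h U))"
      by (rule sum.reindex_bij_betw[OF bij, symmetric])
    also have "\<dots> = (\<Sum>U\<in>Pow W. - (\<sigma> Z U * \<sigma> Z' U))"
      using ne by (intro sum.cong) (auto simp: \<sigma>_def)
    finally show ?thesis using False by (simp add: sum_negf)
  qed
  have "(\<Sum>U\<in>Pow W. (\<Sum>Z\<in>B. \<sigma> Z U)\<^sup>2) = (\<Sum>U\<in>Pow W. \<Sum>Z\<in>B. \<Sum>Z'\<in>B. \<sigma> Z U * \<sigma> Z' U)"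
    by (simp add: power2_eq_square sum_product)
  also have "\<dots> = (\<Sum>Z\<in>B. \<Sum>Z'\<in>B. \<Sum>U\<in>Pow W. \<sigma> Z U * \<sigma> Z' U)"
    by (subst sum.swap, rule sum.cong[OF refl], rule sum.swap)
  also have "\<dots> = (\<Sum>Z\<in>B. \<Sum>Z'\<in>B. if Z = Z' then 2 ^ card W else 0)"
    using orth by (intro sum.cong) auto
  also have "\<dots> = real (card B) * 2 ^ card W" using assms by simp
  finally show ?thesis .
qed

text \<open>Chebyshev: with M edges in direction \<open>i\<close>, fewer than 9M/20 sensitive ones
  push the sum of signs at least M/10 away from 0, while its mean square is M. The exceptional
  fraction is therefore at most 100/M.\<close>

lemma card_few_sens_edges_le:
  assumes "finite N" "C \<subseteq> N" "i \<in> C"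
  shows "2^(card C - 1) * card {U\<in>Pow (Pow N). 20 * card (sens_edges i C U) < 9 * 2^(card C - 1)}
     \<le> 100 * card (Pow (Pow N))"
proof -
  define B where "B = Pow (C-{i})"
  define M :: nat where "M = 2^(card C - 1)"
  define W where "W = Pow N"
  define \<sigma> where "\<sigma> \<equiv> \<lambda>Z U. if (Z \<in> U) \<noteq> (insert i Z \<in> U) then 1 else (-1::real)"
  define bad where "bad = {U\<in>Pow W. 20 * card (sens_edges i C U) < 9 * M}"
  have finC: "finite C" using assms finite_subset by blast
  have B: "finite B" "card B = M" "B \<subseteq> W" 
    using finC assms by (auto simp: B_def M_def W_def card_Pow)
  have W: "finite W" using assms by (simp add: W_def)
  have dev: "(real M)\<^sup>2 / 100 \<le> (\<Sum>Z\<in>B. \<sigma> Z U)\<^sup>2" if "U \<in> bad" for U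
  proof -
    have E: "sens_edges i C U \<subseteq> B" by (auto simp: sens_edges_def B_def)
    have "(\<Sum>Z\<in>B. \<sigma> Z U) = (\<Sum>Z\<in>B. 2 * of_bool (Z \<in> sens_edges i C U) - 1)"
      by (intro sum.cong) (auto simp: \<sigma>_def sens_edges_def B_def)
    also have "\<dots> = 2 * real (card (sens_edges i C U)) - real M"
      using B E by (simp add: sum_subtractf sum_distrib_left[symmetric] Int_absorb1 Int_commute)
    finally have eq: "(\<Sum>Z\<in>B. \<sigma> Z U) = 2 * real (card (sens_edges i C U)) - real M" .
    have "real (20 * card (sens_edges i C U)) < real (9 * M)"
      using that unfolding bad_def by (simp only: of_nat_less_iff) simp
    then have "real M / 10 \<le> real M - 2 * real (card (sens_edges i C U))" by simp
    then have "(real M / 10)\<^sup>2 \<le> (real M - 2 * real (card (sens_edges i C U)))\<^sup>2"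
      by (intro power_mono) auto
    then show ?thesis unfolding eq by (simp add: power_divide power2_commute)
  qed
  have "real (card bad) * ((real M)\<^sup>2 / 100) = (\<Sum>U\<in>bad. (real M)\<^sup>2 / 100)" by simp
  also have "\<dots> \<le> (\<Sum>U\<in>bad. (\<Sum>Z\<in>B. \<sigma> Z U)\<^sup>2)" using dev by (rule sum_mono)
  also have "\<dots> \<le> (\<Sum>U\<in>Pow W. (\<Sum>Z\<in>B. \<sigma> Z U)\<^sup>2)"
    using W by (intro sum_mono2) (auto simp: bad_def)
  also have "\<dots> = real M * 2 ^ card W"
    using sum_sq_edge_signs[OF W B(1) B(3), of i] B(2) unfolding \<sigma>_def by (force simp: B_def)
  finally have "real M * (real M * real (card bad)) \<le> real M * (100 * 2 ^ card W)"
    by (simp add: power2_eq_square field_simps)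
  then have "real M * real (card bad) \<le> 100 * 2 ^ card W"
    by (simp add: M_def)
  then have "real (M * card bad) \<le> real (100 * card (Pow W))"
    using W by (simp add: card_Pow)
  then show ?thesis unfolding of_nat_le_iff M_def bad_def W_def .
qed

section \<open>The hard functions\<close>

definition ones :: "bool list \<Rightarrow> nat set" where
  "ones x = {i. i < length x \<and> x ! i}"

text \<open>The thresholds (k+t)/2 and (k-t)/2 are doubled to avoid division, and in
  \<open>low\<close> the \<open>t\<close> is moved across to avoid truncated subtraction.\<close>

definition high :: "nat \<Rightarrow> nat \<Rightarrow> nat set \<Rightarrow> bool" where
  "high k t Y \<longleftrightarrow> k + t \<le> 2 * card Y"

definition low :: "nat \<Rightarrow> nat \<Rightarrow> nat set \<Rightarrow> bool" where
  "low k t Y \<longleftrightarrow> 2 * card Y + t \<le> k"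

text \<open>\<open>r\<close> selects the no function. Only the members of \<open>U\<close> inside
  \<open>C\<close> matter, but \<open>U\<close> may be any family, so that one sample space of
  families serves every \<open>C\<close>.\<close>

definition hard_fun :: "bool \<Rightarrow> nat \<Rightarrow> nat \<Rightarrow> nat set \<Rightarrow> nat set set \<Rightarrow> nat set \<Rightarrow> bool" where
  "hard_fun r k t C U X \<longleftrightarrow>
     high k t (X - C) \<and> X \<inter> C \<in> U \<or> low k t (X - C) \<and> (X \<inter> C \<in> U) \<noteq> r"

lemma ones_bij: "bij_betw ones (cube n) (Pow {..<n})"
  by (rule bij_betwI[where g="\<lambda>X. map (\<lambda>i. i \<in> X) [0..<n]"])
     (auto simp: ones_def cube_def intro!: nth_equalityI)

lemma card_cube_ones: "card {x\<in>cube n. P (ones x)} = card {X\<in>Pow {..<n}. P X}"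
proof -
  have im: "ones ` cube n = Pow {..<n}" and inj: "inj_on ones (cube n)"
    using ones_bij[of n] by (auto simp: bij_betw_def)
  have "ones ` {x\<in>cube n. P (ones x)} = {X\<in>Pow {..<n}. P X}"
    unfolding im[symmetric] by auto
  moreover have "inj_on ones {x\<in>cube n. P (ones x)}"
    using inj by (rule inj_on_subset) auto
  ultimately show ?thesis by (metis card_image)
qed

section \<open>Distances of the hard functions from the juntas\<close>

lemma fdist_nonneg: "fdist n f g \<ge> 0"
  by (simp add: fdist_def)

lemma dist_junta_le:
  assumes "is_junta n k g"
  shows "dist_junta n k f \<le> fdist n f g"
  unfolding dist_junta_def
  by (rule cInf_lower) (use assms fdist_nonneg in \<open>auto intro!: bdd_belowI[where m=0]\<close>)

lemma dist_junta_ge: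
  assumes "\<And>g. is_junta n k g \<Longrightarrow> c \<le> fdist n f g"
  shows "c \<le> dist_junta n k f"
  unfolding dist_junta_def
proof (rule cInf_greatest)
  have "is_junta n k (\<lambda>_. True)" by (auto simp: is_junta_def intro!: exI[where x="{}"])
  then show "{fdist n f g |g. is_junta n k g} \<noteq> {}" by blast
qed (use assms in auto)

text \<open>The witnessing junta is u itself, which depends on \<open>C\<close> alone; the
  overwritten band is the only place where the two differ.\<close>

lemma dist_junta_yes:
  assumes C: "C \<subseteq> {..<2*k}" "card C = k" and t: "100 * t\<^sup>2 \<le> k"
  shows "dist_junta (2*k) k (\<lambda>x. hard_fun False k t C U (ones x)) \<le> 0.1"
proof -
  let ?N = "{..<2*k}" and ?g = "\<lambda>x. ones x \<inter> C \<in> U"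
  have "is_junta (2*k) k ?g"
    unfolding is_junta_def
  proof (intro exI[where x=C] conjI ballI impI)
    fix x y assume "x \<in> cube (2*k)" "y \<in> cube (2*k)" "\<forall>i\<in>C. x!i = y!i"
    then have "ones x \<inter> C = ones y \<inter> C" by (auto simp: ones_def cube_def)
    then show "?g x = ?g y" by simp
  qed (use C in auto)
  then have "dist_junta (2*k) k (\<lambda>x. hard_fun False k t C U (ones x))
      \<le> fdist (2*k) (\<lambda>x. hard_fun False k t C U (ones x)) ?g"
    by (rule dist_junta_le)
  also have "\<dots> \<le> 0.1"
  proof -
    let ?mid = "\<lambda>Y. k < 2 * card Y + t \<and> 2 * card Y < k + t"
    have fC: "finite C" using C finite_subset by blast
    have cA: "card (?N - C) = k" using C fC by (simp add: card_Diff_subset)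
    have "card {x\<in>cube (2*k). hard_fun False k t C U (ones x) \<noteq> (ones x \<inter> C \<in> U)}
       = card {X\<in>Pow ?N. hard_fun False k t C U X \<noteq> (X \<inter> C \<in> U)}"
      by (rule card_cube_ones)
    also have "\<dots> \<le> card {X\<in>Pow ?N. True \<and> ?mid (X - C)}"
      by (intro card_mono) (auto simp: hard_fun_def high_def low_def)
    also have "\<dots> = 2^k * card {Y\<in>Pow (?N - C). ?mid Y}"
      using C fC card_Pow_split[of ?N C "\<lambda>_. True" ?mid] by (simp add: card_Pow flip: Pow_def)
    finally have "10 * card {x\<in>cube (2*k). hard_fun False k t C U (ones x) \<noteq> (ones x \<inter> C \<in> U)}
        \<le> 2^k * (10 * card {Y\<in>Pow (?N - C). ?mid Y})" by simp
    also have "\<dots> \<le> 2^k * 2^k"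
      using card_middle_le[OF _ cA t] by (intro mult_left_mono) auto
    also have "\<dots> = 2^(2*k)" by (simp add: mult_2 power_add)
    finally have "real (10 * card {x\<in>cube (2*k). hard_fun False k t C U (ones x) \<noteq> (ones x \<inter> C \<in> U)})
        \<le> real (2^(2*k))" unfolding of_nat_le_iff .
    then show ?thesis by (simp add: fdist_def field_simps)
  qed
  finally show ?thesis .
qed

lemma card_outer_ge:
  assumes A: "finite A" "card A = k" and t: "100 * t\<^sup>2 \<le> k"
  shows "9 * 2^k \<le> 10 * card {Y\<in>Pow A. high k t Y \<or> low k t Y}"
proof -
  let ?O = "{Y\<in>Pow A. high k t Y \<or> low k t Y}"
  let ?M = "{Y\<in>Pow A. k < 2 * card Y + t \<and> 2 * card Y < k + t}"
  have "card (Pow A) \<le> card (?O \<union> ?M)"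
    using A by (intro card_mono) (auto simp: high_def low_def)
  also have "\<dots> \<le> card ?O + card ?M" by (rule card_Un_le)
  finally show ?thesis using card_middle_le[OF A t] A by (simp add: card_Pow)
qed

lemma high_compl_low:
  assumes "finite A" "card A = k" "Y \<subseteq> A"
  shows "low k t (A - Y) \<longleftrightarrow> high k t Y"
proof -
  have "card (A - Y) = k - card Y" "card Y \<le> k"
    using assms by (auto simp: card_Diff_subset finite_subset card_mono)
  then show ?thesis by (auto simp: low_def high_def)
qed

text \<open>Complementation within \<open>A\<close> swaps the two sides of the band, so each gets
  half of the outer measure 9/10.\<close>

lemma card_high_ge:
  assumes A: "finite A" "card A = k" and t: "100 * t\<^sup>2 \<le> k"
  shows "9 * 2^k \<le> 20 * card {Y\<in>Pow A. high k t Y}"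
proof -
  have "bij_betw (\<lambda>Y. A - Y) {Y\<in>Pow A. high k t Y} {Y\<in>Pow A. low k t Y}"
  proof (rule bij_betwI[where g="\<lambda>Y. A - Y"])
    show "(\<lambda>Y. A - Y) \<in> {Y\<in>Pow A. low k t Y} \<rightarrow> {Y\<in>Pow A. high k t Y}"
    proof
      fix Y assume Y: "Y \<in> {Y\<in>Pow A. low k t Y}"
      then have "A - (A - Y) = Y" by auto
      then show "A - Y \<in> {Y\<in>Pow A. high k t Y}"
        using Y high_compl_low[OF A, of "A - Y" t] by auto
    qed
  qed (use high_compl_low[OF A] in auto)
  then have "card {Y\<in>Pow A. low k t Y} = card {Y\<in>Pow A. high k t Y}"
    by (simp add: bij_betw_same_card)
  moreover have "card {Y\<in>Pow A. high k t Y \<or> low k t Y}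
      \<le> card {Y\<in>Pow A. high k t Y} + card {Y\<in>Pow A. low k t Y}"
    using card_Un_le[of "{Y\<in>Pow A. high k t Y}" "{Y\<in>Pow A. low k t Y}"]
    by (simp add: Collect_disj_eq[symmetric] conj_disj_distribL)
  ultimately show ?thesis using card_outer_ge[OF A t] by linarith
qed

text \<open>The pairs {X, h X} for X in \<open>P\<close> are disjoint, and each contains a point of
  \<open>E\<close>. With \<open>E\<close> the error set of a junta, this turns a pairing of inputs
  into a distance bound.\<close>

lemma card_le_of_displaced_hits:
  assumes "finite E" "\<And>X. X \<in> P \<Longrightarrow> X \<in> E \<or> h X \<in> E" "inj_on h P" "P \<inter> h ` P = {}"
  shows "card P \<le> card E"
proof -
  let ?p = "\<lambda>X. if X \<in> E then X else h X"
  have "inj_on ?p P"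
    using assms(3,4) by (auto simp: inj_on_def split: if_splits)
  moreover have "?p ` P \<subseteq> E" using assms(2) by auto
  ultimately show ?thesis using assms(1) card_inj_on_le by blast
qed

text \<open>A junta set \<open>S\<close> of size at most \<open>k\<close> either equals \<open>C\<close>, and then cannot see the
  high/low side that decides the sign, or misses some \<open>i \<in> C\<close>, and then errs on one end of
  every sensitive edge in direction \<open>i\<close>.\<close>

lemma dist_junta_no:
  assumes C: "C \<subseteq> {..<2*k}" "card C = k" and t: "100 * t\<^sup>2 \<le> k" "t > 0"
    and sens: "\<And>i. i \<in> C \<Longrightarrow> 9 * 2^(k-1) \<le> 20 * card (sens_edges i C U)"
  shows "0.2 \<le> dist_junta (2*k) k (\<lambda>x. hard_fun True k t C U (ones x))"
proof (rule dist_junta_ge)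
  fix g assume "is_junta (2*k) k g"
  then obtain S where S: "S \<subseteq> {..<2*k}" "card S \<le> k"
    and gS: "\<And>x y. x \<in> cube (2*k) \<Longrightarrow> y \<in> cube (2*k) \<Longrightarrow> \<forall>i\<in>S. x!i = y!i \<Longrightarrow> g x = g y"
    unfolding is_junta_def by blast
  let ?N = "{..<2*k}"
  let ?A = "?N - C"
  define G where "G = (\<lambda>X. g (map (\<lambda>i. i \<in> X) [0..<2*k]))"
  have G_ones: "G (ones x) = g x" if "x \<in> cube (2*k)" for x
  proof -
    have "map (\<lambda>i. i \<in> ones x) [0..<2*k] = x"
      using that by (auto simp: ones_def cube_def intro!: nth_equalityI)
    then show ?thesis by (simp add: G_def)
  qed
  have GS: "G X = G Y" if "X \<inter> S = Y \<inter> S" for X Y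
    unfolding G_def
  proof (rule gS)
    show "\<forall>i\<in>S. map (\<lambda>i. i \<in> X) [0..<2*k] ! i = map (\<lambda>i. i \<in> Y) [0..<2*k] ! i"
    proof
      fix i assume "i \<in> S"
      then have "i < 2*k" "i \<in> X \<longleftrightarrow> i \<in> Y" using S that by auto
      then show "map (\<lambda>i. i \<in> X) [0..<2*k] ! i = map (\<lambda>i. i \<in> Y) [0..<2*k] ! i" by simp
    qed
  qed (auto simp: cube_def)
  have fC: "finite C" and fS: "finite S" using C S finite_subset by blast+
  have A: "finite ?A" "card ?A = k" using C fC by (auto simp: card_Diff_subset)
  define F where "F = hard_fun True k t C U"
  define E where "E = {X\<in>Pow ?N. F X \<noteq> G X}"
  have fE: "finite E" by (simp add: E_def)
  \<comment> \<open>Here t > 0 matters: for t = 0 weight exactly k/2 would lie on both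
    sides.\<close>
  have hl: "\<not> (high k t Y \<and> low k t Y)" for Y using t by (auto simp: high_def low_def)
  have "{x\<in>cube (2*k). F (ones x) \<noteq> g x} = {x\<in>cube (2*k). F (ones x) \<noteq> G (ones x)}"
    using G_ones by auto
  then have dE: "fdist (2*k) (\<lambda>x. F (ones x)) g = card E / 2^(2*k)"
    unfolding fdist_def E_def card_cube_ones[symmetric] by simp
  have k2: "(2::nat)^(2*k) = 2^k * 2^k" by (simp add: mult_2 power_add)
  have "2^(2*k) \<le> 5 * card E"
  proof (cases "C \<subseteq> S")
    case True
    then have "S = C" using card_seteq[OF fS True] S C by simp
    define P where "P = {X\<in>Pow ?N. True \<and> high k t (X - C)}"
    \<comment> \<open>\<open>h\<close> keeps the \<open>C\<close>-part and complements the rest. It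
      exchanges high and low, so \<open>F\<close> changes sign, whereas \<open>G\<close> sees only
      \<open>C\<close> and cannot change. One error per pair gives measure at least 9/20.\<close>
    define h where "h = (\<lambda>X. X \<inter> C \<union> (?A - X))"
    have h: "h X \<inter> C = X \<inter> C" "h X - C = ?A - (X - C)" "h X \<subseteq> ?N" for X
      using C by (auto simp: h_def)
    have hlow: "low k t (h X - C)" if "X \<in> P" for X
      using that high_compl_low[OF A, of "X - C" t] unfolding h by (auto simp: P_def)
    have "card P \<le> card E"
    proof (rule card_le_of_displaced_hits[where h=h])
      fix X assume X: "X \<in> P"
      have "G (h X) = G X" using h \<open>S = C\<close> by (intro GS) auto
      moreover have "F (h X) \<noteq> F X"
        using hlow[OF X] X hl[of "h X - C"] hl[of "X - C"] h(1)
        by (auto simp: F_def hard_fun_def P_def)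
      ultimately show "X \<in> E \<or> h X \<in> E" using h(3)[of X] X by (auto simp: E_def P_def)
    next
      show "inj_on h P"
        by (rule inj_on_inverseI[where g=h]) (use C in \<open>auto simp: h_def P_def\<close>)
      have "h X \<notin> P" if "X \<in> P" for X using hlow[OF that] hl[of "h X - C"] by (simp add: P_def)
      then show "P \<inter> h ` P = {}" by blast
    qed (rule fE)
    moreover have "card P = 2^k * card {Y\<in>Pow ?A. high k t Y}"
      unfolding P_def using C fC card_Pow_split[of ?N C "\<lambda>_. True" "high k t"]
      by (simp add: card_Pow flip: Pow_def)
    moreover have "2^k * (9 * 2^k) \<le> 2^k * (20 * card {Y\<in>Pow ?A. high k t Y})"
      using card_high_ge[OF A t(1)] by (intro mult_left_mono) auto
    ultimately show ?thesis unfolding k2 by linarith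
  next
    case False
    then obtain i where i: "i \<in> C" "i \<notin> S" by blast
    let ?out = "\<lambda>Y. high k t Y \<or> low k t Y"
    \<comment> \<open>Lower endpoints of sensitive edges, outside the band. Adding \<open>i\<close>
      changes \<open>F\<close> but not \<open>G\<close>, since \<open>i\<close> lies in
      \<open>C\<close> and not in \<open>S\<close>.\<close>
    define P where "P = {X\<in>Pow ?N. X \<inter> C \<in> sens_edges i C U \<and> ?out (X - C)}"
    have Pi: "i \<notin> X" if "X \<in> P" for X using that i by (auto simp: P_def sens_edges_def)
    have h: "insert i X \<inter> C = insert i (X \<inter> C)" "insert i X - C = X - C" for X using i by auto
    have "card P \<le> card E"
    proof (rule card_le_of_displaced_hits[where h="insert i"])
      fix X assume X: "X \<in> P"
      have "G (insert i X) = G X" using i by (intro GS) auto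
      moreover have "F (insert i X) \<noteq> F X"
        using X hl[of "X - C"] unfolding F_def hard_fun_def h P_def sens_edges_def by blast
      ultimately show "X \<in> E \<or> insert i X \<in> E" using X i C by (auto simp: E_def P_def)
    next
      show "inj_on (insert i) P" using Pi unfolding inj_on_def by (metis insert_ident)
      show "P \<inter> insert i ` P = {}" using Pi by blast
    qed (rule fE)
    moreover have "card P = card (sens_edges i C U) * card {Y\<in>Pow ?A. ?out Y}"
    proof -
      have "{Z\<in>Pow C. Z \<in> sens_edges i C U} = sens_edges i C U" by (auto simp: sens_edges_def)
      then show ?thesis unfolding P_def
        using card_Pow_split[of ?N C "\<lambda>Z. Z \<in> sens_edges i C U" ?out] C by simp
    qed
    \<comment> \<open>The error measure is at least (1/2)(9/20)(9/10) = 81/400, just above 1/5; the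
      factor 1/2 arises because only one endpoint of each edge is counted.\<close>
    moreover have "(9 * 2^(k-1)) * (9 * 2^k) \<le>
        (20 * card (sens_edges i C U)) * (10 * card {Y\<in>Pow ?A. ?out Y})"
      by (intro mult_mono sens[OF i(1)] card_outer_ge[OF A t(1)]) auto
    ultimately have "81 * (2^(k-1) * 2^k) \<le> 200 * card E" by linarith
    moreover have "2 * (2::nat)^(k-1) = 2^k"
      using i C fC by (metis card_gt_0_iff empty_iff power_eq_if not_gr_zero)
    then have "2 * (2^(k-1) * 2^k) = 2^k * (2::nat)^k" by (metis mult.assoc)
    ultimately have "2^k * 2^k * 81 \<le> 400 * card E" by linarith
    then show ?thesis unfolding k2 by linarith
  qed
  then have "real (2^(2*k)) \<le> real (5 * card E)" unfolding of_nat_le_iff .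
  then show "0.2 \<le> fdist (2*k) (\<lambda>x. hard_fun True k t C U (ones x)) g"
    unfolding dE[unfolded F_def] by (simp add: field_simps)
qed

section \<open>Indistinguishability\<close>

definition collision :: "nat \<Rightarrow> nat \<Rightarrow> bool list list \<Rightarrow> nat set \<Rightarrow> bool" where
  "collision k t Q C \<longleftrightarrow> (\<exists>x\<in>set Q. \<exists>y\<in>set Q.
     ones x \<inter> C = ones y \<inter> C \<and> high k t (ones x - C) \<and> low k t (ones y - C))"

text \<open>A union bound over at most q^2 ordered pairs of queries. Opposite sides of the band
  force the two queries to differ in at least \<open>t\<close> coordinates, and equal
  \<open>C\<close>-parts force \<open>C\<close> to avoid all of these.\<close>

lemma card_collision_le:
  assumes "length Q \<le> q" "set Q \<subseteq> cube (2*k)"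
  shows "2^t * card {C. C \<subseteq> {..<2*k} \<and> card C = k \<and> collision k t Q C} \<le> q\<^sup>2 * ((2*k) choose k)"
proof -
  let ?R = "\<lambda>x y. {C. C \<subseteq> {..<2*k} \<and> card C = k \<and> ones x \<inter> C = ones y \<inter> C \<and>
                high k t (ones x - C) \<and> low k t (ones y - C)}"
  have one: "2^t * card (?R x y) \<le> (2*k) choose k" if xy: "x \<in> set Q" "y \<in> set Q" for x y
  \<comment> \<open>The differing set \<open>D\<close> does not depend on \<open>C\<close>, so a
    single colliding \<open>C\<close> suffices to show that \<open>D\<close> has at least
    \<open>t\<close> elements.\<close>
  proof (cases "?R x y = {}")
    case True then show ?thesis by (simp only: card.empty)
  next
    case False
    define D where "D = sym_diff (ones x) (ones y)"
    have on: "ones x \<subseteq> {..<2*k}" "ones y \<subseteq> {..<2*k}"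
      using xy assms(2) by (auto simp: ones_def cube_def)
    then have D: "D \<subseteq> {..<2*k}" and fo: "finite (ones x)" "finite (ones y)"
      by (auto simp: D_def intro: finite_subset)
    from False obtain C where C: "ones x \<inter> C = ones y \<inter> C"
      "high k t (ones x - C)" "low k t (ones y - C)" by blast
    have "ones x - C \<subseteq> (ones y - C) \<union> D" by (auto simp: D_def)
    then have "card (ones x - C) \<le> card ((ones y - C) \<union> D)"
      using fo by (intro card_mono) (auto simp: D_def)
    also have "\<dots> \<le> card (ones y - C) + card D" by (rule card_Un_le)
    finally have tD: "t \<le> card D" using C by (auto simp: high_def low_def)
    have "card (?R x y) \<le> card {C. C \<subseteq> {..<2*k} \<and> card C = k \<and> C \<inter> D = {}}"
      by (intro card_mono) (auto simp: D_def)
    then have "2^t * card (?R x y) \<le> 2^t * card {C. C \<subseteq> {..<2*k} \<and> card C = k \<and> C \<inter> D = {}}"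
      by simp
    also have "\<dots> \<le> (2*k) choose k" by (rule card_avoiding_subsets_le[OF D tD])
    finally show ?thesis .
  qed
  let ?QQ = "set Q \<times> set Q"
  have "{C. C \<subseteq> {..<2*k} \<and> card C = k \<and> collision k t Q C} = (\<Union>(x,y)\<in>?QQ. ?R x y)"
    by (auto simp: collision_def)
  then have "card {C. C \<subseteq> {..<2*k} \<and> card C = k \<and> collision k t Q C}
      \<le> (\<Sum>p\<in>?QQ. card (case p of (x,y) \<Rightarrow> ?R x y))"
    using card_UN_le[of ?QQ "\<lambda>p. case p of (x,y) \<Rightarrow> ?R x y"] by simp
  then have "2^t * card {C. C \<subseteq> {..<2*k} \<and> card C = k \<and> collision k t Q C}
      \<le> (\<Sum>p\<in>?QQ. 2^t * card (case p of (x,y) \<Rightarrow> ?R x y))"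
    by (simp add: sum_distrib_left[symmetric])
  also have "\<dots> \<le> (\<Sum>p\<in>?QQ. (2*k) choose k)"
    using one by (intro sum_mono) auto
  also have "\<dots> = (card (set Q))\<^sup>2 * ((2*k) choose k)"
    by (simp add: card_cartesian_product power2_eq_square)
  also have "\<dots> \<le> q\<^sup>2 * ((2*k) choose k)"
    using card_length[of Q] assms(1) by (intro mult_right_mono power_mono) auto
  finally show ?thesis .
qed

text \<open>Without a collision, toggling \<open>U\<close> at the control parts of all low queries turns the
  answers of the far function into those of the close one.\<close>

lemma no_collision_sum_eq:
  assumes "\<not> collision k t Q C" "C \<subseteq> N"
  shows "(\<Sum>U\<in>Pow (Pow N). of_bool (D (map (\<lambda>x. hard_fun True k t C U (ones x)) Q)) :: real) =
     (\<Sum>U\<in>Pow (Pow N). of_bool (D (map (\<lambda>x. hard_fun False k t C U (ones x)) Q)))"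
proof -
  define V where "V = {ones y \<inter> C | y. y \<in> set Q \<and> low k t (ones y - C)}"
  have bij: "bij_betw (\<lambda>U. sym_diff U V) (Pow (Pow N)) (Pow (Pow N))"
    by (rule bij_betwI[where g="\<lambda>U. sym_diff U V"]) (use assms(2) in \<open>auto simp: V_def\<close>)
  have eq: "hard_fun False k t C (sym_diff U V) (ones x) = hard_fun True k t C U (ones x)"
    if x: "x \<in> set Q" for U x
  proof -
    \<comment> \<open>A low query has its \<open>C\<close>-part in \<open>V\<close>, so the toggle
      cancels the negation; a high one has it outside \<open>V\<close>, as there is no collision; in
      the band both functions are False.\<close>
    have "ones x \<inter> C \<in> V" if "low k t (ones x - C)" using that x by (auto simp: V_def)
    moreover have "ones x \<inter> C \<notin> V" if "high k t (ones x - C)"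
      using that x assms(1) unfolding V_def collision_def by blast
    ultimately show ?thesis unfolding hard_fun_def by blast
  qed
  have "(\<Sum>U\<in>Pow (Pow N). of_bool (D (map (\<lambda>x. hard_fun False k t C U (ones x)) Q)) :: real)
     = (\<Sum>U\<in>Pow (Pow N). of_bool (D (map (\<lambda>x. hard_fun False k t C (sym_diff U V) (ones x)) Q)))"
    by (rule sum.reindex_bij_betw[OF bij, symmetric])
  also have "\<dots> = (\<Sum>U\<in>Pow (Pow N). of_bool (D (map (\<lambda>x. hard_fun True k t C U (ones x)) Q)))"
  proof (rule sum.cong[OF refl])
    fix U
    have "map (\<lambda>x. hard_fun False k t C (sym_diff U V) (ones x)) Q
        = map (\<lambda>x. hard_fun True k t C U (ones x)) Q" using eq by simp
    then show "(of_bool (D (map (\<lambda>x. hard_fun False k t C (sym_diff U V) (ones x)) Q)) :: real)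
      = of_bool (D (map (\<lambda>x. hard_fun True k t C U (ones x)) Q))" by (simp only:)
  qed
  finally show ?thesis by simp
qed

text \<open>For fixed queries and decision rule, a \<open>C\<close> without collision contributes
  equally to both sums. A colliding \<open>C\<close> costs at most the number of families, and such
  \<open>C\<close> form a fraction of at most q^2/2^t.\<close>

lemma sum_accept_diff_le:
  assumes Q: "length Q \<le> q" "set Q \<subseteq> cube (2*k)"
  defines "\<C> \<equiv> {C. C \<subseteq> {..<2*k} \<and> card C = k}" and "\<U> \<equiv> Pow (Pow {..<2*k})"
  shows "(\<Sum>C\<in>\<C>. \<Sum>U\<in>\<U>. of_bool (D (map (\<lambda>x. hard_fun False k t C U (ones x)) Q)))
     \<le> (\<Sum>C\<in>\<C>. \<Sum>U\<in>\<U>. of_bool (D (map (\<lambda>x. hard_fun True k t C U (ones x)) Q)))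
        + real (card \<C>) * real (card \<U>) * (real q)\<^sup>2 / 2^t"
proof -
  let ?f = "\<lambda>r C U. of_bool (D (map (\<lambda>x. hard_fun r k t C U (ones x)) Q)) :: real"
  have fin: "finite \<C>" "finite \<U>" by (auto simp: \<C>_def \<U>_def)
  have cC: "card \<C> = (2*k) choose k" by (simp add: \<C>_def n_subsets)
  have "(\<Sum>U\<in>\<U>. ?f False C U) \<le> (\<Sum>U\<in>\<U>. ?f True C U) + of_bool (collision k t Q C) * real (card \<U>)"
    if "C \<in> \<C>" for C
  proof (cases "collision k t Q C")
    case True
    have "(\<Sum>U\<in>\<U>. ?f False C U) \<le> (\<Sum>U\<in>\<U>. 1)" by (intro sum_mono) auto
    moreover have "0 \<le> (\<Sum>U\<in>\<U>. ?f True C U)" by (intro sum_nonneg) auto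
    ultimately show ?thesis using True by simp
  next
    case False
    then show ?thesis
      using no_collision_sum_eq[OF False, of "{..<2*k}" D] that by (simp add: \<C>_def \<U>_def)
  qed
  then have "(\<Sum>C\<in>\<C>. \<Sum>U\<in>\<U>. ?f False C U)
      \<le> (\<Sum>C\<in>\<C>. (\<Sum>U\<in>\<U>. ?f True C U) + of_bool (collision k t Q C) * real (card \<U>))"
    by (rule sum_mono)
  also have "\<dots> = (\<Sum>C\<in>\<C>. \<Sum>U\<in>\<U>. ?f True C U) + real (card (\<C> \<inter> {C. collision k t Q C})) * real (card \<U>)"
    using fin by (simp add: sum.distrib sum_distrib_right[symmetric])
  also have "real (card (\<C> \<inter> {C. collision k t Q C})) \<le> (real q)\<^sup>2 * real (card \<C>) / 2^t"
  proof -
    have "\<C> \<inter> {C. collision k t Q C} = {C. C \<subseteq> {..<2*k} \<and> card C = k \<and> collision k t Q C}"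
      by (auto simp: \<C>_def)
    then have "2^t * card (\<C> \<inter> {C. collision k t Q C}) \<le> q\<^sup>2 * card \<C>"
      using card_collision_le[OF Q, of t] cC by simp
    then have "real (2^t * card (\<C> \<inter> {C. collision k t Q C})) \<le> real (q\<^sup>2 * card \<C>)"
      unfolding of_nat_le_iff .
    then show ?thesis by (simp add: field_simps)
  qed
  finally show ?thesis by (simp add: mult_right_mono algebra_simps)
qed

section \<open>Averaging over the tester and the query bound\<close>

lemma accept_prob_expectation:
  "accept_prob T f = measure_pmf.expectation T (\<lambda>(Q, D). of_bool (D (map f Q)))"
proof -
  have "(\<lambda>(Q, D). of_bool (D (map f Q)) :: real) = indicator {(Q, D). D (map f Q)}"
    by (auto simp: fun_eq_iff indicator_def)
  then show ?thesis by (simp add: accept_prob_def)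
qed

text \<open>Exchanging the sum over hard functions with the randomness of the tester allows the
  query list to be fixed first, as in Yao's principle.\<close>

lemma sum_accept_prob:
  "(\<Sum>C\<in>I. \<Sum>U\<in>J. accept_prob T (f C U)) =
     measure_pmf.expectation T (\<lambda>(Q, D). \<Sum>C\<in>I. \<Sum>U\<in>J. of_bool (D (map (f C U) Q)))"
proof -
  let ?h = "\<lambda>g p. (case p of (Q, D) \<Rightarrow> of_bool (D (map g Q))) :: real"
  have int: "integrable (measure_pmf T) (?h g)" for g
    by (rule measure_pmf.integrable_const_bound[where B=1]) (auto simp: AE_measure_pmf_iff)
  have "measure_pmf.expectation T (\<lambda>p. \<Sum>C\<in>I. \<Sum>U\<in>J. ?h (f C U) p)
     = (\<Sum>C\<in>I. \<Sum>U\<in>J. accept_prob T (f C U))"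
    by (simp add: accept_prob_expectation int)
  moreover have "(\<lambda>p. \<Sum>C\<in>I. \<Sum>U\<in>J. ?h (f C U) p) =
     (\<lambda>(Q, D). \<Sum>C\<in>I. \<Sum>U\<in>J. of_bool (D (map (f C U) Q)))" by auto
  ultimately show ?thesis by simp
qed

text \<open>On average the tester accepts yes functions with probability at least 2/3 and no
  functions with at most 1/3 + 1/12 = 5/12, where 1/12 covers the families that may fail to give a
  far function. The gap 1/4 must be at most q^2/2^t.\<close>

lemma tester_queries_sq_ge:
  assumes T: "nonadaptive_tester (2*k) q T" "tolerant_junta_tester (2*k) k 0.1 0.2 T"
    and t: "100 * t\<^sup>2 \<le> k" "t > 0" and k: "2400 * k \<le> 2^k"
  shows "2^t \<le> 4 * (real q)\<^sup>2"
proof -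
  define \<C> where "\<C> = {C. C \<subseteq> {..<2*k} \<and> card C = k}"
  define \<U> where "\<U> = Pow (Pow {..<2*k})"
  define c where "c = real (card \<C>)"
  define u where "u = real (card \<U>)"
  define acc where "acc = (\<lambda>r C U. accept_prob T (\<lambda>x. hard_fun r k t C U (ones x)))"
  have fin: "finite \<C>" "finite \<U>" by (auto simp: \<C>_def \<U>_def)
  have pos: "c > 0" "u > 0" by (auto simp: c_def u_def \<C>_def \<U>_def n_subsets card_Pow)
  have acc1: "acc r C U \<le> 1" for r C U by (simp add: acc_def accept_prob_def)
  have yes: "2/3 \<le> acc False C U" if "C \<in> \<C>" for C U
    using T(2) dist_junta_yes[of C k t U] that t by (auto simp: tolerant_junta_tester_def acc_def \<C>_def)
  define few where "few = (\<lambda>C. \<Union>i\<in>C. {U\<in>\<U>. 20 * card (sens_edges i C U) < 9 * 2^(k-1)})"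
  have no: "acc True C U \<le> 1/3 + of_bool (U \<in> few C)" if C: "C \<in> \<C>" and U: "U \<in> \<U>" for C U
  proof (cases "U \<in> few C")
    case True then show ?thesis using acc1[of True C U] by simp
  next
    case False
    then have "0.2 \<le> dist_junta (2*k) k (\<lambda>x. hard_fun True k t C U (ones x))"
      using C U t by (intro dist_junta_no) (auto simp: \<C>_def few_def not_less)
    then have "2/3 \<le> 1 - acc True C U" using T(2) by (auto simp: tolerant_junta_tester_def acc_def)
    then show ?thesis by simp
  qed
  \<comment> \<open>A union bound over the k directions in \<open>C\<close>: the exceptional
    fraction is at most 100k/2^(k-1) = 200k/2^k, which is at most 1/12 by 2400k <= 2^k.\<close>
  have few: "real (card (few C)) \<le> u / 12" if C: "C \<in> \<C>" for C
  proof -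
    have Ck: "finite C" "card C = k" "C \<subseteq> {..<2*k}" using C by (auto simp: \<C>_def intro: finite_subset)
    have "2^(k-1) * card (few C) \<le> 2^(k-1) * (\<Sum>i\<in>C. card {U\<in>\<U>. 20 * card (sens_edges i C U) < 9 * 2^(k-1)})"
      unfolding few_def using Ck by (intro mult_left_mono card_UN_le) auto
    also have "\<dots> \<le> (\<Sum>i\<in>C. 100 * card \<U>)"
      unfolding sum_distrib_left
      using card_few_sens_edges_le[OF _ Ck(3)] Ck(2) by (intro sum_mono) (simp add: \<U>_def)
    finally have "2^(k-1) * card (few C) \<le> 100 * k * card \<U>" using Ck by (simp add: mult_ac)
    then have "24 * (2^(k-1) * card (few C)) \<le> (2400 * k) * card \<U>" by linarith
    also have "\<dots> \<le> 2^k * card \<U>" using k by (intro mult_right_mono) auto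
    also have "2^k = 2 * (2::nat)^(k-1)" using t by (cases k) auto
    finally have "2^(k-1) * (12 * card (few C)) \<le> 2^(k-1) * card \<U>" by simp
    then have "12 * card (few C) \<le> card \<U>" by simp
    then show ?thesis unfolding u_def by linarith
  qed
  have "c * u * (2/3) \<le> (\<Sum>C\<in>\<C>. \<Sum>U\<in>\<U>. acc False C U)"
  proof -
    have "(\<Sum>C\<in>\<C>. \<Sum>U\<in>\<U>. 2/3) \<le> (\<Sum>C\<in>\<C>. \<Sum>U\<in>\<U>. acc False C U)"
      using yes by (intro sum_mono) auto
    then show ?thesis by (simp add: c_def u_def)
  qed
  also have "\<dots> \<le> (\<Sum>C\<in>\<C>. \<Sum>U\<in>\<U>. acc True C U) + c * u * (real q)\<^sup>2 / 2^t"
  proof -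
    \<comment> \<open>The number of hard functions accepted when the tester draws \<open>p\<close>;
      it is bounded by c * u, hence integrable.\<close>
    let ?h = "\<lambda>r (p :: bool list list \<times> (bool list \<Rightarrow> bool)). (case p of (Q, D) \<Rightarrow>
       \<Sum>C\<in>\<C>. \<Sum>U\<in>\<U>. of_bool (D (map (\<lambda>x. hard_fun r k t C U (ones x)) Q))) :: real"
    have int: "integrable (measure_pmf T) (?h r)" for r
    proof (rule measure_pmf.integrable_const_bound[where B="c * u"])
      have "\<bar>?h r p\<bar> \<le> c * u" for p
      proof -
        obtain Q D where p: "p = (Q, D)" by force
        have "(\<Sum>C\<in>\<C>. \<Sum>U\<in>\<U>. of_bool (D (map (\<lambda>x. hard_fun r k t C U (ones x)) Q)) :: real)
            \<le> (\<Sum>C\<in>\<C>. \<Sum>U\<in>\<U>. 1)" by (intro sum_mono) auto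
        moreover have "0 \<le> (\<Sum>C\<in>\<C>. \<Sum>U\<in>\<U>. of_bool (D (map (\<lambda>x. hard_fun r k t C U (ones x)) Q)) :: real)"
          by (intro sum_nonneg) auto
        ultimately show ?thesis by (simp add: p c_def u_def)
      qed
      then show "AE p in measure_pmf T. norm (?h r p) \<le> c * u" by simp
    qed simp
    have "measure_pmf.expectation T (?h False)
        \<le> measure_pmf.expectation T (\<lambda>p. ?h True p + c * u * (real q)\<^sup>2 / 2^t)"
    proof (rule integral_mono_AE)
      show "AE p in measure_pmf T. ?h False p \<le> ?h True p + c * u * (real q)\<^sup>2 / 2^t"
      proof (rule AE_pmfI)
        fix p assume p: "p \<in> set_pmf T"
        obtain Q D where pQ: "p = (Q, D)" by force
        have "length Q \<le> q" "set Q \<subseteq> cube (2*k)"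
          using T(1) p pQ by (auto simp: nonadaptive_tester_def)
        from sum_accept_diff_le[OF this]
        show "?h False p \<le> ?h True p + c * u * (real q)\<^sup>2 / 2^t"
          by (simp add: pQ c_def u_def \<C>_def \<U>_def)
      qed
    qed (auto intro: int)
    then show ?thesis unfolding acc_def sum_accept_prob using int by simp
  qed
  also have "(\<Sum>C\<in>\<C>. \<Sum>U\<in>\<U>. acc True C U) \<le> c * u * (5/12)"
  proof -
    have "(\<Sum>U\<in>\<U>. acc True C U) \<le> u * (5/12)" if C: "C \<in> \<C>" for C
    proof -
      have sub: "\<U> \<inter> few C = few C" by (auto simp: few_def)
      have "(\<Sum>U\<in>\<U>. acc True C U) \<le> (\<Sum>U\<in>\<U>. 1/3 + of_bool (U \<in> few C))"
        using no[OF C] by (intro sum_mono) auto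
      also have "\<dots> = u / 3 + real (card (few C))"
        using fin sub by (simp add: sum.distrib u_def)
      also have "\<dots> \<le> u * (5/12)" using few[OF C] by simp
      finally show ?thesis .
    qed
    then have "(\<Sum>C\<in>\<C>. \<Sum>U\<in>\<U>. acc True C U) \<le> (\<Sum>C\<in>\<C>. u * (5/12))" by (rule sum_mono)
    then show ?thesis by (simp add: c_def)
  qed
  finally have "(c * u) * (1/4) \<le> (c * u) * ((real q)\<^sup>2 / 2^t)" by (simp add: algebra_simps)
  then have "1/4 \<le> (real q)\<^sup>2 / 2^t" using pos by (subst (asm) mult_le_cancel_left_pos) auto
  then show ?thesis by (simp add: field_simps)
qed

theorem theorem1p2:
  shows "\<exists>\<gamma>::real. \<gamma> > 0 \<and> (\<exists>K::nat. \<forall>k\<ge>K. \<forall>(q::nat) T.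
           nonadaptive_tester (2 * k) q T \<and> tolerant_junta_tester (2 * k) k 0.1 0.2 T
           \<longrightarrow> real q \<ge> 2 powr (\<gamma> * sqrt (real k)))"
\<comment> \<open>With s = sqrt k and t > s/10 - 1, the bound q >= 2^(t/2 - 1) yields q >= 2^(s/20 -
  3/2). This is at least 2^(s/40) once s >= 60, that is k >= 3600.\<close>
proof (intro exI[where x="1/40"] exI[where x=3600] conjI allI impI)
  fix k q :: nat and T
  assume k: "3600 \<le> k"
    and T: "nonadaptive_tester (2 * k) q T \<and> tolerant_junta_tester (2 * k) k 0.1 0.2 T"
  define s where "s = sqrt (real k)"
  define t where "t = nat \<lfloor>s / 10\<rfloor>"
  have s: "s \<ge> 60" "s\<^sup>2 = real k" using k by (auto simp: s_def intro!: real_le_rsqrt)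
  have t: "real t \<le> s / 10" "s / 10 - 1 < real t" unfolding t_def using s by linarith+
  have t0: "t > 0" using t s by simp
  have "(10 * real t)\<^sup>2 \<le> s\<^sup>2" using t by (intro power_mono) auto
  then have "real (100 * t\<^sup>2) \<le> real k" using s by (simp add: power_mult_distrib)
  then have tk: "100 * t\<^sup>2 \<le> k" unfolding of_nat_le_iff .
  have "2400 * k \<le> 2^k" using k
  proof (induction k rule: dec_induct)
    case base
    have "(2400::nat) * 3600 \<le> 2^24" by simp
    also have "\<dots> \<le> 2^3600" by (rule power_increasing) auto
    finally show ?case .
  next
    case (step n) then show ?case by simp
  qed
  from tester_queries_sq_ge[OF _ _ tk t0 this] T have "2^t \<le> 4 * (real q)\<^sup>2" by blast
  moreover have "(2 * 2 powr (s / 40))\<^sup>2 \<le> (2::real)^t"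
  proof -
    have "(2 * 2 powr (s / 40))\<^sup>2 = 2 powr (2 + s / 20)"
      by (simp add: power2_eq_square powr_add flip: powr_add[of 2 "s/40" "s/40"])
    also have "\<dots> \<le> 2 powr real t" using s t by (intro powr_mono) auto
    finally show ?thesis by (simp add: powr_realpow)
  qed
  ultimately have "(2 * 2 powr (s / 40))\<^sup>2 \<le> 4 * (real q)\<^sup>2" by (rule order_trans[rotated])
  then have "(2 * 2 powr (s / 40))\<^sup>2 \<le> (2 * real q)\<^sup>2" by (simp only: power_mult_distrib) simp
  then have "2 * 2 powr (s / 40) \<le> 2 * real q" by (rule power2_le_imp_le) simp
  then show "2 powr (1/40 * sqrt (real k)) \<le> real q" by (simp add: s_def)
qed simp

end
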